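(* Let $d\geq 1$, let $\Omega$ be an open connected subset of $\mathbb{R}^d$, and let $\sigma\in L^1_+(\Omega)$ be any probability density on $\Omega$. Let $\{X_i\}_{i\geq 1}$ be a sequence of independent, identically distributed, absolutely continuous random variables in $\Omega$ with density $\sigma$, and let $\{\mathbf{x}_i\}_{i\geq 1}$ be the random point sequence obtained by sampling $\{X_i\}_{i\geq 1}$. Let $\varepsilon>0$ be real, let $k\geq 1$ be an integer, let $\beta>1$ be a real number with $\beta\notin\mathbb{N}$, and let $$\phi(r)=\left(1+(\varepsilon r)^{2k}\right)^{\beta},\qquad r\geq 0.$$ For $n\geq 1$ let $V_n$ be the $n\times n$ matrix $$V_n=[\phi_j(\mathbf{x}_i)]_{1\leq i,j\leq n},\qquad \phi_j(\mathbf{x})=\phi(\|\mathbf{x}-\mathbf{x}_j\|_2).$$ Then, for every $n\geq 1$, the points $\mathbf{x}_1,\dots,\mathbf{x}_n$ are almost surely distinct and the matrix $V_n$ is almost surely nonsingular.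
   Context: The functions $\phi(r)=(1+(\varepsilon r)^{2k})^{\beta}$ are called Generalized MultiQuadrics (GMQ), with shape parameter $\varepsilon>0$; the parameters $\varepsilon,k,\beta$ are fixed (deterministic). $\|\cdot\|_2$ is the Euclidean norm on $\mathbb{R}^d$. $L^1_+(\Omega)$ denotes the nonnegative Lebesgue-integrable functions on $\Omega$; a probability density $\sigma$ satisfies $\int_\Omega \sigma(\mathbf{x})\,d\mathbf{x}=1$, and "absolutely continuous with density $\sigma$" means that each $X_i$ has law $\sigma(\mathbf{x})\,d\mathbf{x}$ with respect to Lebesgue measure on $\Omega$. "Almost surely" means with probability one with respect to the joint law of the sequence $\{X_i\}_{i\ge 1}$. $V_n$ is the interpolation matrix whose radial basis function centers coincide with the sampling points, with no polynomial terms added. *)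

theory Defs
  imports "HOL-Probability.Probability" "Jordan_Normal_Form.Determinant"
begin

definition gmq :: "real \<Rightarrow> nat \<Rightarrow> real \<Rightarrow> real \<Rightarrow> real" where
  "gmq \<epsilon> k \<beta> r = (1 + (\<epsilon> * r) ^ (2 * k)) powr \<beta>"

text \<open>The points are indexed from 1, while the entries of \<^typ>\<open>'a mat\<close> are indexed from 0.\<close>

definition interpolation_matrix ::
    "(real \<Rightarrow> real) \<Rightarrow> (nat \<Rightarrow> 'b::real_normed_vector) \<Rightarrow> nat \<Rightarrow> real mat" where
  "interpolation_matrix \<phi> x n = mat n n (\<lambda>(i, j). \<phi> (norm (x (Suc i) - x (Suc j))))"

end

theory Submission
  imports Defs "HOL-Complex_Analysis.Complex_Analysis"
begin

text \<open>
  The determinant is an analytic function along every line on which a single point moves, so by Fubini it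
  vanishes only on a null set as soon as it is nonzero for one configuration. Such a configuration is built
  on a line by induction. Let \<open>A\<close> be the inverse of the matrix of the points \<open>\<tau> 0, \<dots>, \<tau> (n - 1)\<close>. If every
  additional point \<open>t\<close> gave a singular matrix, then \<open>\<Sum>i j. A i j * \<Phi> i t * \<Phi> j t = 1\<close> for all \<open>t\<close>, where
  \<open>\<Phi> i z = (1 + (z - \<tau> i) ^ (2 * k)) powr \<beta>\<close>. This identity extends to a complex strip. On its boundary lies
  a branch point of \<open>\<Phi> M\<close>, for \<open>\<tau> M\<close> the greatest point, at which all other \<open>\<Phi> i\<close> are analytic. Comparing
  orders of vanishing there (\<open>\<beta>\<close> is not an integer) shows that the coefficient of \<open>\<Phi> M\<close> vanishes, and by
  linear independence of the \<open>\<Phi> i\<close> row \<open>M\<close> of \<open>A\<close> is zero off the diagonal. As no entry of the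
  matrix vanishes, this is only possible for \<open>n = 1\<close>, which is checked directly.
\<close>

section \<open>Orders of vanishing along a ray\<close>

text \<open>Only the modulus is compared with \<open>y powr p\<close>, so the branch of a complex
  power does not matter and \<open>p\<close> may be any real number. As \<open>c > 0\<close> is
  demanded, a function that is zero near 0 has no order.\<close>

definition vanishing_order :: "(real \<Rightarrow> complex) \<Rightarrow> real \<Rightarrow> bool" where
  "vanishing_order e p \<longleftrightarrow> (\<exists>c>0. ((\<lambda>y. norm (e y) / y powr p) \<longlongrightarrow> c) (at_right 0))"

lemma vanishing_order_cong:
  assumes "\<forall>\<^sub>F y in at_right 0. norm (e y) = norm (e' y)" and "vanishing_order e p"
  shows "vanishing_order e' p"
proof -
  obtain c where "c > 0" and c: "((\<lambda>y. norm (e y) / y powr p) \<longlongrightarrow> c) (at_right 0)"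
    using assms(2) unfolding vanishing_order_def by blast
  have "((\<lambda>y. norm (e' y) / y powr p) \<longlongrightarrow> c) (at_right 0)"
    by (rule Lim_transform_eventually[OF c]) (use assms(1) in eventually_elim, simp)
  thus ?thesis unfolding vanishing_order_def using \<open>c > 0\<close> by blast
qed

lemma vanishing_order_mult:
  assumes "vanishing_order e p" and "vanishing_order f q"
  shows "vanishing_order (\<lambda>y. e y * f y) (p + q)"
proof -
  obtain c d where "c > 0" "d > 0" and c: "((\<lambda>y. norm (e y) / y powr p) \<longlongrightarrow> c) (at_right 0)"
    and d: "((\<lambda>y. norm (f y) / y powr q) \<longlongrightarrow> d) (at_right 0)"
    using assms unfolding vanishing_order_def by blast
  have "((\<lambda>y. norm (e y * f y) / y powr (p + q)) \<longlongrightarrow> c * d) (at_right 0)"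
    using tendsto_mult[OF c d] by (simp add: norm_mult powr_add)
  thus ?thesis unfolding vanishing_order_def using \<open>c > 0\<close> \<open>d > 0\<close> by (intro exI[of _ "c * d"]) simp
qed

lemma vanishing_order_cmult:
  assumes "vanishing_order e p" and "a \<noteq> 0"
  shows "vanishing_order (\<lambda>y. a * e y) p"
proof -
  obtain c where "c > 0" and c: "((\<lambda>y. norm (e y) / y powr p) \<longlongrightarrow> c) (at_right 0)"
    using assms unfolding vanishing_order_def by blast
  have "((\<lambda>y. norm (a * e y) / y powr p) \<longlongrightarrow> norm a * c) (at_right 0)"
    using tendsto_mult[OF tendsto_const[of "norm a"] c] by (simp add: norm_mult)
  thus ?thesis unfolding vanishing_order_def
    using \<open>c > 0\<close> \<open>a \<noteq> 0\<close> by (intro exI[of _ "norm a * c"]) simp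
qed

lemma vanishing_order_higher:
  assumes "vanishing_order f q" and "p < q"
  shows "((\<lambda>y. norm (f y) / y powr p) \<longlongrightarrow> 0) (at_right 0)"
proof -
  obtain d where d: "((\<lambda>y. norm (f y) / y powr q) \<longlongrightarrow> d) (at_right 0)"
    using assms unfolding vanishing_order_def by blast
  have "((\<lambda>y::real. y powr (q - p)) \<longlongrightarrow> 0) (at_right 0)"
    using \<open>p < q\<close> by real_asymp
  from tendsto_mult[OF this d] show ?thesis
    by (rule_tac Lim_transform_eventually)
       (auto intro!: eventually_mono[OF eventually_at_right_less[of 0]] simp: powr_diff field_simps)
qed

lemma vanishing_order_le:
  assumes "vanishing_order e p" and "vanishing_order e q"
  shows "q \<le> p"
proof (rule ccontr)
  assume "\<not> q \<le> p"
  hence "((\<lambda>y. norm (e y) / y powr p) \<longlongrightarrow> 0) (at_right 0)"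
    using vanishing_order_higher assms(2) by simp
  moreover obtain c where "c > 0" and "((\<lambda>y. norm (e y) / y powr p) \<longlongrightarrow> c) (at_right 0)"
    using assms(1) unfolding vanishing_order_def by blast
  ultimately show False using tendsto_unique[OF trivial_limit_at_right_real] by fastforce
qed

lemma vanishing_order_unique:
  "vanishing_order e p \<Longrightarrow> vanishing_order e q \<Longrightarrow> p = q"
  using vanishing_order_le by (metis order_antisym)

text \<open>If \<open>e\<close> is zero near 0, the quotients for \<open>p\<close> and
  \<open>p + 1\<close> agree there, so \<open>e\<close> would have both orders.\<close>

lemma vanishing_order_not_zero:
  assumes "\<forall>\<^sub>F y in at_right 0. e y = 0"
  shows "\<not> vanishing_order e p"
proof
  assume "vanishing_order e p"
  hence "vanishing_order e (p + 1)"
  proof -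
    obtain c where "c > 0" and c: "((\<lambda>y. norm (e y) / y powr p) \<longlongrightarrow> c) (at_right 0)"
      using \<open>vanishing_order e p\<close> unfolding vanishing_order_def by blast
    have "((\<lambda>y. norm (e y) / y powr (p + 1)) \<longlongrightarrow> c) (at_right 0)"
      by (rule Lim_transform_eventually[OF c]) (use assms in eventually_elim, simp)
    thus ?thesis unfolding vanishing_order_def using \<open>c > 0\<close> by blast
  qed
  with vanishing_order_unique[OF \<open>vanishing_order e p\<close>] show False by fastforce
qed

lemma vanishing_order_add:
  assumes e: "vanishing_order e p" and f: "vanishing_order f q" and "p < q"
  shows "vanishing_order (\<lambda>y. e y + f y) p"
proof -
  obtain c where "c > 0" and c: "((\<lambda>y. norm (e y) / y powr p) \<longlongrightarrow> c) (at_right 0)"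
    using e unfolding vanishing_order_def by blast
  have f0: "((\<lambda>y. norm (f y) / y powr p) \<longlongrightarrow> 0) (at_right 0)"
    using vanishing_order_higher[OF f \<open>p < q\<close>] .
  have "((\<lambda>y. norm (e y + f y) / y powr p) \<longlongrightarrow> c) (at_right 0)"
  proof (rule tendsto_sandwich)
    show "\<forall>\<^sub>F y in at_right 0. norm (e y) / y powr p - norm (f y) / y powr p \<le> norm (e y + f y) / y powr p"
      by (intro always_eventually)
         (auto simp: diff_divide_distrib[symmetric] intro!: divide_right_mono norm_diff_ineq)
    show "\<forall>\<^sub>F y in at_right 0. norm (e y + f y) / y powr p \<le> norm (e y) / y powr p + norm (f y) / y powr p"
      by (intro always_eventually)
         (auto simp: add_divide_distrib[symmetric] intro!: divide_right_mono norm_triangle_ineq)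
    show "((\<lambda>y. norm (e y) / y powr p - norm (f y) / y powr p) \<longlongrightarrow> c) (at_right 0)"
      using tendsto_diff[OF c f0] by simp
    show "((\<lambda>y. norm (e y) / y powr p + norm (f y) / y powr p) \<longlongrightarrow> c) (at_right 0)"
      using tendsto_add[OF c f0] by simp
  qed
  thus ?thesis unfolding vanishing_order_def using \<open>c > 0\<close> by blast
qed

lemma vanishing_order_add_distinct:
  assumes "vanishing_order e p" and "vanishing_order f q" and "p \<noteq> q"
  shows "vanishing_order (\<lambda>y. e y + f y) (min p q)"
  using vanishing_order_add[OF assms(1,2)] vanishing_order_add[OF assms(2,1)] assms(3)
  by (cases "p < q") (auto simp: add.commute min_def)

text \<open>The sum \<open>e + f\<close> has the smaller of the distinct orders \<open>p\<close> and
  \<open>q\<close>, or order \<open>q\<close> if \<open>e\<close> is zero. This is not a natural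
  number, whereas \<open>g = - (e + f)\<close> is zero or has a natural order.\<close>

lemma vanishing_orders_no_cancellation:
  assumes sum: "\<forall>\<^sub>F y in at_right 0. e y + f y + g y = 0"
    and e: "(\<forall>\<^sub>F y in at_right 0. e y = 0) \<or> (vanishing_order e p \<and> p \<notin> \<nat> \<and> p \<noteq> q)"
    and f: "vanishing_order f q" and q: "q \<notin> \<nat>"
    and g: "(\<forall>\<^sub>F y in at_right 0. g y = 0) \<or> (\<exists>n. vanishing_order g (real n))"
  shows False
proof -
  obtain r where r: "vanishing_order (\<lambda>y. e y + f y) r" and "r \<notin> \<nat>"
    using e
  proof
    assume "\<forall>\<^sub>F y in at_right 0. e y = 0"
    hence "\<forall>\<^sub>F y in at_right 0. norm (f y) = norm (e y + f y)"
      by eventually_elim simp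
    from that[OF vanishing_order_cong[OF this f] q] show thesis .
  next
    assume *: "vanishing_order e p \<and> p \<notin> \<nat> \<and> p \<noteq> q"
    from that[OF vanishing_order_add_distinct[OF _ f]] * q show thesis
      by (auto simp: min_def split: if_splits)
  qed
  have "\<forall>\<^sub>F y in at_right 0. norm (e y + f y) = norm (g y)"
    using sum by eventually_elim (metis add_eq_0_iff norm_minus_cancel)
  from vanishing_order_cong[OF this r] have gr: "vanishing_order g r" .
  from g show False
  proof
    assume "\<forall>\<^sub>F y in at_right 0. g y = 0"
    thus False using vanishing_order_not_zero gr by blast
  next
    assume "\<exists>n. vanishing_order g (real n)"
    thus False using vanishing_order_unique[OF gr] \<open>r \<notin> \<nat>\<close> by auto
  qed
qed

section \<open>Orders of analytic functions and of powers\<close>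

text \<open>The ray descends vertically from \<open>z\<close>. It will be used for \<open>z\<close>
  on the upper edge of a horizontal strip, which it enters.\<close>

lemma filterlim_ray:
  "filterlim (\<lambda>y. z - \<i> * of_real y) (at z) (at_right (0::real))"
proof -
  have "((\<lambda>y::real. z - \<i> * of_real y) \<longlongrightarrow> z - \<i> * of_real 0) (at_right 0)"
    by (intro tendsto_intros)
  moreover have "\<forall>\<^sub>F y in at_right (0::real). z - \<i> * of_real y \<noteq> z"
    using eventually_at_right_less[of 0] by eventually_elim simp
  ultimately show ?thesis by (simp add: filterlim_at)
qed

text \<open>A function that is not locally zero factors near \<open>z\<close> as
  \<open>g w * (w - z) ^ n\<close> with \<open>g z \<noteq> 0\<close>, and \<open>w - z\<close> has
  modulus \<open>y\<close> on the ray.\<close>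

lemma analytic_vanishing_order:
  assumes "f analytic_on {z}"
  shows "(\<forall>\<^sub>F w in nhds z. f w = 0) \<or> (\<exists>n::nat. vanishing_order (\<lambda>y. f (z - \<i> * of_real y)) (real n))"
proof -
  obtain r where "r > 0" and hol: "f holomorphic_on ball z r"
    using assms unfolding analytic_on_def by auto
  show ?thesis
  proof (cases "\<exists>w\<in>ball z r. f w \<noteq> 0")
    case False
    hence "\<forall>\<^sub>F w in nhds z. f w = 0"
      using \<open>r > 0\<close> eventually_nhds_in_open[of "ball z r" z] by (auto elim!: eventually_mono)
    thus ?thesis ..
  next
    case True
    define g n where "g = zor_poly f z" and "n = nat (zorder f z)"
    obtain s where "s > 0" and g: "g holomorphic_on cball z s"
      and fg: "\<And>w. w \<in> cball z s \<Longrightarrow> f w = g w * (w - z) ^ n \<and> g w \<noteq> 0"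
      using zorder_exist_zero[OF hol open_ball connected_ball _ True] \<open>r > 0\<close>
      unfolding g_def n_def by (metis centre_in_ball)
    have "isCont g z"
      using holomorphic_on_imp_continuous_on[OF g] \<open>s > 0\<close>
      by (metis centre_in_ball continuous_on_interior interior_cball)
    hence lim: "((\<lambda>y. norm (g (z - \<i> * of_real y))) \<longlongrightarrow> norm (g z)) (at_right 0)"
      using filterlim_compose[OF _ filterlim_ray] by (intro tendsto_norm) (auto simp: isCont_def)
    have "\<forall>\<^sub>F y in at_right 0. z - \<i> * of_real y \<in> cball z s"
      using filterlim_ray[of z] \<open>s > 0\<close> eventually_at_in_open'[of "ball z s" z]
      unfolding filterlim_iff by (auto elim!: eventually_mono allE)
    hence "\<forall>\<^sub>F y in at_right 0. norm (g (z - \<i> * of_real y))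
        = norm (f (z - \<i> * of_real y)) / y powr real n"
      using eventually_at_right_less[of 0]
      by eventually_elim (simp add: fg norm_mult norm_power powr_realpow)
    from Lim_transform_eventually[OF lim this]
    show ?thesis
      using fg[of z] \<open>s > 0\<close> unfolding vanishing_order_def by (intro disjI2 exI[of _ n] exI[of _ "norm (g z)"]) auto
  qed
qed

lemma simple_zero_vanishing_order:
  assumes "(f has_field_derivative D) (at z)" and "f z = 0" and "D \<noteq> 0"
  shows "vanishing_order (\<lambda>y. f (z - \<i> * of_real y)) 1"
proof -
  have "((\<lambda>w. (f w - f z) / (w - z)) \<longlongrightarrow> D) (at z)"
    using assms(1) by (simp add: has_field_derivative_iff)
  from tendsto_norm[OF filterlim_compose[OF this filterlim_ray]]
  have "((\<lambda>y. norm (f (z - \<i> * of_real y)) / \<bar>y\<bar>) \<longlongrightarrow> norm D) (at_right 0)"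
    by (simp add: assms(2) norm_divide norm_mult)
  moreover have "\<forall>\<^sub>F y in at_right 0. norm (f (z - \<i> * of_real y)) / \<bar>y\<bar>
      = norm (f (z - \<i> * of_real y)) / y powr 1"
    using eventually_at_right_less[of 0] by eventually_elim simp
  ultimately have "((\<lambda>y. norm (f (z - \<i> * of_real y)) / y powr 1) \<longlongrightarrow> norm D) (at_right 0)"
    by (rule Lim_transform_eventually)
  thus ?thesis unfolding vanishing_order_def using assms(3) by (intro exI[of _ "norm D"]) simp
qed

lemma vanishing_order_powr:
  assumes "vanishing_order e p"
  shows "vanishing_order (\<lambda>y. e y powr of_real b) (b * p)"
proof -
  obtain c where "c > 0" and c: "((\<lambda>y. norm (e y) / y powr p) \<longlongrightarrow> c) (at_right 0)"
    using assms unfolding vanishing_order_def by blast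
  have "((\<lambda>y. (norm (e y) / y powr p) powr b) \<longlongrightarrow> c powr b) (at_right 0)"
    using \<open>c > 0\<close> by (intro tendsto_powr[OF c]) auto
  moreover have "\<forall>\<^sub>F y in at_right 0. (norm (e y) / y powr p) powr b
      = norm (e y powr of_real b) / y powr (b * p)"
    using eventually_at_right_less[of 0]
    by eventually_elim (simp add: norm_powr_real_powr' powr_divide powr_powr mult.commute)
  ultimately have "((\<lambda>y. norm (e y powr of_real b) / y powr (b * p)) \<longlongrightarrow> c powr b) (at_right 0)"
    by (rule Lim_transform_eventually)
  thus ?thesis unfolding vanishing_order_def using \<open>c > 0\<close> by (intro exI[of _ "c powr b"]) simp
qed

section \<open>Translates of the complexified kernel\<close>

text \<open>Among the finitely many roots those closest to the real axis are kept, and of these one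
  with the greatest real part. The first choice gives a strip free of branch points, the second
  separates the branch points of different translates.\<close>

lemma extremal_root_of_minus_one:
  assumes "k \<ge> 1"
  obtains \<zeta> :: complex where "\<zeta> ^ (2 * k) = -1" and "Im \<zeta> > 0"
    and "\<And>w. w ^ (2 * k) = -1 \<Longrightarrow> Im \<zeta> \<le> \<bar>Im w\<bar>"
    and "\<And>w. w ^ (2 * k) = -1 \<Longrightarrow> \<bar>Im w\<bar> = Im \<zeta> \<Longrightarrow> Re w \<le> Re \<zeta>"
proof -
  define R where "R = {w::complex. w ^ (2 * k) = -1}"
  have fin: "finite R"
    unfolding R_def using \<open>k \<ge> 1\<close> by (intro finite_nth_roots) simp
  have "cis (pi / (2 * k)) \<in> R"
  proof -
    have "cis (pi / (2 * k)) ^ (2 * k) = cis (real (2 * k) * (pi / (2 * k)))"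
      by (rule Complex.DeMoivre)
    also have "real (2 * k) * (pi / (2 * k)) = pi" using \<open>k \<ge> 1\<close> by simp
    finally show ?thesis unfolding R_def by simp
  qed
  hence ne: "R \<noteq> {}" by blast
  define h where "h = Min ((\<lambda>w. \<bar>Im w\<bar>) ` R)"
  have h_le: "h \<le> \<bar>Im w\<bar>" if "w \<in> R" for w
    unfolding h_def using fin that by simp
  have "h \<in> (\<lambda>w. \<bar>Im w\<bar>) ` R"
    unfolding h_def using fin ne by (intro Min_in) auto
  define T where "T = {w \<in> R. \<bar>Im w\<bar> = h}"
  have finT: "finite T" and neT: "T \<noteq> {}"
    unfolding T_def using fin \<open>h \<in> _\<close> by auto
  define m where "m = Max (Re ` T)"
  have m_ge: "Re w \<le> m" if "w \<in> T" for w
    unfolding m_def using finT that by simp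
  have "m \<in> Re ` T"
    unfolding m_def using finT neT by (intro Max_in) auto
  then obtain v where v: "v \<in> R" "\<bar>Im v\<bar> = h" "Re v = m"
    unfolding T_def by auto
  have "Im v \<noteq> 0"
  proof
    assume "Im v = 0"
    then obtain x where x: "v = of_real x"
      using complex_is_Real_iff by (auto elim: Reals_cases)
    have "complex_of_real (x ^ (2 * k)) = of_real (-1)"
      using v(1) unfolding R_def by (simp add: x)
    hence "x ^ (2 * k) = -1" by (simp only: of_real_eq_iff)
    moreover have "x ^ (2 * k) \<ge> 0" by (simp add: power_mult)
    ultimately show False by linarith
  qed
  \<comment> \<open>Conjugation permutes the roots and keeps the real part and
    \<open>\<bar>Im w\<bar>\<close>, so the root may be moved to the upper half-plane.\<close>
  define \<zeta> where "\<zeta> = (if Im v > 0 then v else cnj v)"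
  have "cnj v \<in> R"
    using v(1) unfolding R_def by (simp flip: complex_cnj_power)
  hence "\<zeta> \<in> R" "Im \<zeta> = h" "Re \<zeta> = m" "h > 0"
    using v \<open>Im v \<noteq> 0\<close> unfolding \<zeta>_def by auto
  show thesis
    using \<open>\<zeta> \<in> R\<close> \<open>Im \<zeta> = h\<close> \<open>Re \<zeta> = m\<close> \<open>h > 0\<close> h_le m_ge
    by (intro that[of \<zeta>]) (auto simp: R_def T_def)
qed

text \<open>The cuts of the principal power of \<open>1 + w ^ (2 * k)\<close> are the radial rays
  running outward from the roots of -1. Here \<open>\<rho>\<close> is the positive root of order
  \<open>2 * k\<close> of \<open>- w ^ (2 * k)\<close>, which is at least 1.\<close>

lemma nonpos_real_one_plus_power:
  fixes w :: complex
  assumes "k \<ge> 1" and "1 + w ^ (2 * k) \<in> \<real>\<^sub>\<le>\<^sub>0"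
  obtains \<rho> u where "\<rho> \<ge> 1" and "u ^ (2 * k) = -1" and "w = of_real \<rho> * u"
proof -
  obtain x where x: "1 + w ^ (2 * k) = of_real x" "x \<le> 0"
    using assms(2) by (auto elim!: nonpos_Reals_cases)
  define \<rho> where "\<rho> = root (2 * k) (1 - x)"
  have \<rho>: "\<rho> \<ge> 1" "\<rho> ^ (2 * k) = 1 - x"
    using x(2) \<open>k \<ge> 1\<close> unfolding \<rho>_def by auto
  define u where "u = w / of_real \<rho>"
  have "w ^ (2 * k) = - of_real (1 - x)"
    using x(1) by (simp add: algebra_simps)
  hence "u ^ (2 * k) = - of_real (1 - x) / of_real (\<rho> ^ (2 * k))"
    unfolding u_def by (simp add: power_divide)
  also have "\<dots> = -1"
    using x(2) unfolding \<rho>(2) by (simp add: complex_eq_iff del: of_real_diff)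
  finally show thesis
    using that[of \<rho> u] \<rho>(1) unfolding u_def by auto
qed

text \<open>The shape parameter is absent because it will be absorbed into the points by scaling.
  \<open>\<zeta>\<close> is a root as supplied by \<open>extremal_root_of_minus_one\<close>, and
  \<open>of_real t + \<zeta>\<close> is a branch point belonging to the point
  \<open>t\<close>.\<close>

locale gmq_kernel =
  fixes k :: nat and \<beta> :: real and \<zeta> :: complex
  assumes k: "k \<ge> 1" and \<beta>: "\<beta> > 0" "\<beta> \<notin> \<nat>"
    and root: "\<zeta> ^ (2 * k) = -1" and Im_pos: "Im \<zeta> > 0"
    and Im_least: "w ^ (2 * k) = -1 \<Longrightarrow> Im \<zeta> \<le> \<bar>Im w\<bar>"
    and Re_greatest: "w ^ (2 * k) = -1 \<Longrightarrow> \<bar>Im w\<bar> = Im \<zeta> \<Longrightarrow> Re w \<le> Re \<zeta>"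
begin

definition base :: "real \<Rightarrow> complex \<Rightarrow> complex" where
  "base s z = 1 + (z - of_real s) ^ (2 * k)"

definition \<Phi> :: "real \<Rightarrow> complex \<Rightarrow> complex" where
  "\<Phi> s z = base s z powr of_real \<beta>"

text \<open>Its half-width is the least distance of a root of -1 from the real axis. Real
  translations preserve it, so one strip serves all points.\<close>

definition strip :: "complex set" where
  "strip = {z. \<bar>Im z\<bar> < Im \<zeta>}"

lemma open_strip: "open strip"
  unfolding strip_def by (intro open_Collect_less continuous_intros)

lemma connected_strip: "connected strip"
proof (rule convex_connected)
  have "strip = {z. Im z < Im \<zeta>} \<inter> {z. Im z > - Im \<zeta>}"
    unfolding strip_def by auto
  thus "convex strip"
    by (simp add: convex_Int convex_halfspace_Im_gt convex_halfspace_Im_lt)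
qed

text \<open>On a cut \<open>z - of_real s\<close> is \<open>\<rho> * u\<close> with
  \<open>\<rho> \<ge> 1\<close>, hence
  \<open>\<bar>Im z\<bar> \<ge> \<bar>Im u\<bar> \<ge> Im \<zeta>\<close>.\<close>

lemma base_strip:
  assumes "z \<in> strip"
  shows "base s z \<notin> \<real>\<^sub>\<le>\<^sub>0"
proof
  assume "base s z \<in> \<real>\<^sub>\<le>\<^sub>0"
  then obtain \<rho> u where *: "\<rho> \<ge> 1" "u ^ (2 * k) = -1" "z - of_real s = of_real \<rho> * u"
    unfolding base_def using nonpos_real_one_plus_power[OF k] by blast
  have "Im z = \<rho> * Im u" using arg_cong[OF *(3), of Im] by simp
  hence "\<bar>Im u\<bar> \<le> \<bar>Im z\<bar>" using *(1) by (simp add: abs_mult mult_le_cancel_right1)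
  with Im_least[OF *(2)] assms show False unfolding strip_def by simp
qed

text \<open>Minimality of \<open>Im \<zeta>\<close> forces \<open>\<rho> = 1\<close>, so on a cut
  the point seen from \<open>s\<close> would itself be a root. Its real part is
  \<open>t - s + Re \<zeta>\<close>, against the maximality of \<open>Re \<zeta>\<close>.\<close>

lemma base_branch_point:
  assumes "s < t"
  shows "base s (of_real t + \<zeta>) \<notin> \<real>\<^sub>\<le>\<^sub>0"
proof
  assume "base s (of_real t + \<zeta>) \<in> \<real>\<^sub>\<le>\<^sub>0"
  then obtain \<rho> u where *: "\<rho> \<ge> 1" "u ^ (2 * k) = -1" "of_real t + \<zeta> - of_real s = of_real \<rho> * u"
    unfolding base_def using nonpos_real_one_plus_power[OF k] by blast
  have im: "Im \<zeta> = \<rho> * Im u" using arg_cong[OF *(3), of Im] by simp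
  hence "Im \<zeta> = \<rho> * \<bar>Im u\<bar>" using *(1) Im_pos by (simp add: zero_less_mult_iff)
  moreover have "\<rho> * Im \<zeta> \<le> \<rho> * \<bar>Im u\<bar>"
    using Im_least[OF *(2)] *(1) by (intro mult_left_mono) auto
  ultimately have "\<rho> * Im \<zeta> \<le> 1 * Im \<zeta>" by simp
  hence "\<rho> = 1" using *(1) Im_pos by (simp only: mult_le_cancel_right_pos)
  with im *(3) Re_greatest[OF *(2)] Im_pos have "Re u \<le> Re \<zeta>" by simp
  moreover have "t + Re \<zeta> - s = Re u" using arg_cong[OF *(3), of Re] \<open>\<rho> = 1\<close> by simp
  ultimately show False using assms by simp
qed

lemma analytic_base [analytic_intros]: "base s analytic_on S"
  unfolding base_def by (intro analytic_intros)

lemma analytic_\<Phi>: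
  assumes "\<And>z. z \<in> S \<Longrightarrow> base s z \<notin> \<real>\<^sub>\<le>\<^sub>0"
  shows "\<Phi> s analytic_on S"
  unfolding \<Phi>_def using assms by (intro analytic_intros) auto

lemma analytic_\<Phi>_strip [analytic_intros]: "\<Phi> s analytic_on strip"
  by (intro analytic_\<Phi> base_strip)

lemma \<Phi>_of_real:
  "\<Phi> s (of_real t) = of_real ((1 + (t - s) ^ (2 * k)) powr \<beta>)"
proof -
  have "(t - s) ^ (2 * k) \<ge> 0" by (simp add: power_mult)
  hence "\<Phi> s (of_real t) = of_real (1 + (t - s) ^ (2 * k)) powr of_real \<beta>"
    unfolding \<Phi>_def base_def by simp
  also have "\<dots> = of_real ((1 + (t - s) ^ (2 * k)) powr \<beta>)"
    using \<open>(t - s) ^ (2 * k) \<ge> 0\<close> by (intro powr_of_real) simp_all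
  finally show ?thesis .
qed

lemma ray_in_strip:
  "\<forall>\<^sub>F y in at_right 0. of_real t + \<zeta> - \<i> * of_real y \<in> strip"
proof -
  have "\<forall>\<^sub>F y in at_right 0. y < Im \<zeta>"
    using Im_pos eventually_at_right_field by blast
  with eventually_at_right_less[of 0] show ?thesis
    by eventually_elim (simp add: strip_def)
qed

lemma base_order: "vanishing_order (\<lambda>y. base t (of_real t + \<zeta> - \<i> * of_real y)) 1"
proof (rule simple_zero_vanishing_order)
  show "(base t has_field_derivative of_nat (2 * k) * \<zeta> ^ (2 * k - 1)) (at (of_real t + \<zeta>))"
    unfolding base_def by (auto intro!: derivative_eq_intros)
  show "base t (of_real t + \<zeta>) = 0" unfolding base_def by (simp add: root)
  show "of_nat (2 * k) * \<zeta> ^ (2 * k - 1) \<noteq> 0" using k Im_pos by auto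
qed

lemma \<Phi>_order: "vanishing_order (\<lambda>y. \<Phi> t (of_real t + \<zeta> - \<i> * of_real y)) \<beta>"
  using vanishing_order_powr[OF base_order, of t \<beta>] unfolding \<Phi>_def by simp

text \<open>When \<open>2 * \<beta>\<close> is an integer the term \<open>a * \<Phi>\<^sup>2\<close> is analytic and is absorbed into \<open>H\<close>; otherwise the
  orders \<open>2 * \<beta>\<close>, \<open>\<beta> + m\<close> and \<open>n\<close> of the three terms are pairwise distinct.\<close>

lemma \<Phi>_coefficient_eq_0:
  assumes G: "G analytic_on {of_real t + \<zeta>}" and H: "H analytic_on {of_real t + \<zeta>}"
    and eq: "\<And>z. z \<in> strip \<Longrightarrow> a * \<Phi> t z ^ 2 + \<Phi> t z * G z + H z = 0"
  shows "\<forall>\<^sub>F z in nhds (of_real t + \<zeta>). G z = 0"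
proof (rule ccontr)
  assume not0: "\<not> ?thesis"
  define p where "p y = of_real t + \<zeta> - \<i> * of_real y" for y :: real
  obtain m :: nat where "vanishing_order (\<lambda>y. G (p y)) (real m)"
    using analytic_vanishing_order[OF G] not0 unfolding p_def by blast
  with \<Phi>_order have f: "vanishing_order (\<lambda>y. \<Phi> t (p y) * G (p y)) (\<beta> + real m)"
    unfolding p_def by (rule vanishing_order_mult)
  have nat_or: "(\<forall>\<^sub>F y in at_right 0. g (p y) = 0) \<or> (\<exists>n. vanishing_order (\<lambda>y. g (p y)) (real n))"
    if "g analytic_on {of_real t + \<zeta>}" for g
  proof -
    have "\<forall>\<^sub>F y in at_right 0. g (p y) = 0" if "\<forall>\<^sub>F z in nhds (of_real t + \<zeta>). g z = 0"
      using that filterlim_mono[OF filterlim_ray at_within_le_nhds order_refl]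
      unfolding p_def filterlim_iff by blast
    thus ?thesis using analytic_vanishing_order[OF that] unfolding p_def by blast
  qed
  have not_nat: "\<beta> + real m \<notin> \<nat>"
  proof
    assume "\<beta> + real m \<in> \<nat>"
    then obtain j where "\<beta> + real m = real j" by (auto elim: Nats_cases)
    \<comment> \<open>Positivity of \<open>\<beta>\<close> gives \<open>m < j\<close>, so the
      subtraction on naturals is not truncated.\<close>
    hence "\<beta> = real (j - m)" using \<beta>(1) by (simp add: of_nat_diff)
    thus False using \<beta>(2) by simp
  qed
  have pstrip: "\<forall>\<^sub>F y in at_right 0. p y \<in> strip"
    unfolding p_def by (rule ray_in_strip)
  show False
  proof (cases "2 * \<beta> \<in> \<nat>")
    case True
    then obtain N where N: "2 * \<beta> = real N" by (auto elim: Nats_cases)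
    define K where "K z = a * base t z ^ N + H z" for z
    have K: "K analytic_on {of_real t + \<zeta>}"
      unfolding K_def by (intro analytic_intros H)
    have square: "\<Phi> t z ^ 2 = base t z ^ N" if "z \<in> strip" for z
    proof -
      have "base t z \<noteq> 0" using base_strip[OF that, of t] by auto
      have "\<Phi> t z ^ 2 = base t z powr (of_real \<beta> + of_real \<beta>)"
        unfolding \<Phi>_def power2_eq_square powr_add ..
      also have "of_real \<beta> + of_real \<beta> = (of_nat N :: complex)"
        using N by (metis mult_2 of_real_add of_real_of_nat_eq)
      finally show ?thesis using \<open>base t z \<noteq> 0\<close> by (simp add: powr_nat)
    qed
    have "\<forall>\<^sub>F y in at_right 0. 0 + \<Phi> t (p y) * G (p y) + K (p y) = 0"
      using pstrip
    proof eventually_elim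
      case (elim y)
      with eq[OF elim] square[OF elim] show ?case by (simp add: K_def algebra_simps)
    qed
    from vanishing_orders_no_cancellation[OF this _ f not_nat nat_or[OF K]] show False by simp
  next
    case False
    have "\<forall>\<^sub>F y in at_right 0. a * \<Phi> t (p y) ^ 2 + \<Phi> t (p y) * G (p y) + H (p y) = 0"
      using pstrip by eventually_elim (rule eq)
    moreover have "(\<forall>\<^sub>F y in at_right 0. a * \<Phi> t (p y) ^ 2 = 0) \<or>
        vanishing_order (\<lambda>y. a * \<Phi> t (p y) ^ 2) (2 * \<beta>) \<and> 2 * \<beta> \<notin> \<nat> \<and> 2 * \<beta> \<noteq> \<beta> + real m"
    proof (cases "a = 0")
      case False
      have "vanishing_order (\<lambda>y. \<Phi> t (p y) * \<Phi> t (p y)) (\<beta> + \<beta>)"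
        unfolding p_def by (intro vanishing_order_mult \<Phi>_order)
      from vanishing_order_cmult[OF this False] show ?thesis
        using \<open>2 * \<beta> \<notin> \<nat>\<close> \<beta>(2) by (auto simp: power2_eq_square)
    qed simp
    ultimately show False
      by (rule vanishing_orders_no_cancellation[OF _ _ f not_nat nat_or[OF H]])
  qed
qed

text \<open>The greatest point has a branch point at which all other summands are analytic, so its
  coefficient is 0 by \<open>\<Phi>_coefficient_eq_0\<close> with \<open>a = 0\<close> and constant
  \<open>G\<close>. Induction along the order of the points does the rest.\<close>

lemma linear_independence_\<Phi>:
  assumes "finite J" and "inj_on \<tau> J"
    and "\<And>z. z \<in> strip \<Longrightarrow> (\<Sum>j\<in>J. c j * \<Phi> (\<tau> j) z) = 0" and "j \<in> J"
  shows "c j = 0"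
  using assms
proof (induction J arbitrary: j rule: finite_ranking_induct[where f = \<tau>])
  case empty
  thus ?case by simp
next
  case (insert x S)
  show ?case
  \<comment> \<open>The ranking induction does not guarantee that the inserted index is new.\<close>
  proof (cases "x \<in> S")
    case True
    thus ?thesis using insert.IH insert.prems by (simp add: insert_absorb)
  next
    case False
    have less: "\<tau> i < \<tau> x" if "i \<in> S" for i
      using insert.hyps(2)[OF that] insert.prems(1) that False
      by (auto simp: inj_on_def order_less_le)
    define H where "H z = (\<Sum>i\<in>S. c i * \<Phi> (\<tau> i) z)" for z
    have "H analytic_on {of_real (\<tau> x) + \<zeta>}"
      unfolding H_def using less by (intro analytic_intros analytic_\<Phi>) (auto dest: base_branch_point)
    moreover have "0 * \<Phi> (\<tau> x) z ^ 2 + \<Phi> (\<tau> x) z * c x + H z = 0" if "z \<in> strip" for z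
      using insert.prems(2)[OF that] insert.hyps(1) False by (simp add: H_def mult.commute)
    ultimately have "\<forall>\<^sub>F z in nhds (of_real (\<tau> x) + \<zeta>). c x = 0"
      by (intro \<Phi>_coefficient_eq_0[where G = "\<lambda>_. c x" and a = 0 and H = H]) auto
    hence "c x = 0" by (rule eventually_nhds_x_imp_x)
    moreover have "c i = 0" if "i \<in> S" for i
      using insert.IH[OF _ _ that] insert.prems(1,2) insert.hyps(1) False \<open>c x = 0\<close> by simp
    ultimately show ?thesis using insert.prems(3) by auto
  qed
qed

end

section \<open>A nonsingular collinear configuration\<close>

text \<open>The shape parameter is scaled to 1, and unlike the sampling points these points are
  indexed from 0.\<close>

definition collinear_matrix :: "nat \<Rightarrow> real \<Rightarrow> (nat \<Rightarrow> real) \<Rightarrow> nat \<Rightarrow> real mat" where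
  "collinear_matrix k \<beta> \<tau> n = mat n n (\<lambda>(i, j). (1 + (\<tau> i - \<tau> j) ^ (2 * k)) powr \<beta>)"

section \<open>Bordered matrices and quadratic forms\<close>

lemma det_nonzero_inverse:
  fixes v :: "nat \<Rightarrow> nat \<Rightarrow> 'a::field"
  assumes "det (mat n n (\<lambda>(i, j). v i j)) \<noteq> 0"
  obtains a where "\<And>i j. i < n \<Longrightarrow> j < n \<Longrightarrow> (\<Sum>l<n. a i l * v l j) = (if i = j then 1 else 0)"
    and "\<And>i j. i < n \<Longrightarrow> j < n \<Longrightarrow> (\<Sum>l<n. v i l * a l j) = (if i = j then 1 else 0)"
proof -
  define V where "V = mat n n (\<lambda>(i, j). v i j)"
  have V: "V \<in> carrier_mat n n" unfolding V_def by simp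
  from det_non_zero_imp_unit[OF V] assms obtain A where A: "A \<in> carrier_mat n n"
    and AV: "A * V = 1\<^sub>m n" and VA: "V * A = 1\<^sub>m n"
    unfolding V_def[symmetric] Units_def ring_mat_def by auto
  show thesis
  proof (rule that[of "\<lambda>i j. A $$ (i, j)"])
    fix i j assume ij: "i < n" "j < n"
    have "(\<Sum>l<n. A $$ (i, l) * v l j) = (A * V) $$ (i, j)"
      using ij A V by (simp add: scalar_prod_def V_def lessThan_atLeast0)
    thus "(\<Sum>l<n. A $$ (i, l) * v l j) = (if i = j then 1 else 0)" using ij AV by simp
    have "(\<Sum>l<n. v i l * A $$ (l, j)) = (V * A) $$ (i, j)"
      using ij A V by (simp add: scalar_prod_def V_def lessThan_atLeast0)
    thus "(\<Sum>l<n. v i l * A $$ (l, j)) = (if i = j then 1 else 0)" using ij VA by simp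
  qed
qed

text \<open>This is the vanishing of a Schur complement. The first \<open>n\<close> rows express a
  kernel vector \<open>w\<close> through its last entry, which is therefore nonzero, and the last
  row then reads \<open>(1 - q) * w $ n = 0\<close> for the value \<open>q\<close> of the quadratic
  form.\<close>

lemma bordered_singular:
  fixes v a :: "nat \<Rightarrow> nat \<Rightarrow> 'a::field" and b :: "nat \<Rightarrow> 'a"
  assumes inv: "\<And>i j. i < n \<Longrightarrow> j < n \<Longrightarrow> (\<Sum>l<n. a i l * v l j) = (if i = j then 1 else 0)"
    and sing: "det (mat (Suc n) (Suc n) (\<lambda>(i, j). v i j)) = 0"
    and col: "\<And>i. i < n \<Longrightarrow> v i n = b i" and row: "\<And>i. i < n \<Longrightarrow> v n i = b i" and corner: "v n n = 1"
  shows "(\<Sum>i<n. \<Sum>j<n. a i j * b i * b j) = 1"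
proof -
  define V where "V = mat (Suc n) (Suc n) (\<lambda>(i, j). v i j)"
  have V: "V \<in> carrier_mat (Suc n) (Suc n)" unfolding V_def by simp
  obtain w where w: "w \<in> carrier_vec (Suc n)" "w \<noteq> 0\<^sub>v (Suc n)" "V *\<^sub>v w = 0\<^sub>v (Suc n)"
    using det_0_iff_vec_prod_zero[OF V] sing unfolding V_def by auto
  have eq: "(\<Sum>j<n. v i j * w $ j) + v i n * w $ n = 0" if "i < Suc n" for i
  proof -
    have "(V *\<^sub>v w) $ i = (\<Sum>j<Suc n. v i j * w $ j)"
      using that w(1) by (simp add: V_def scalar_prod_def lessThan_atLeast0)
    thus ?thesis using w(3) that by simp
  qed
  have sol: "w $ i = - (\<Sum>l<n. a i l * b l) * w $ n" if "i < n" for i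
  proof -
    have "0 = (\<Sum>l<n. a i l * ((\<Sum>j<n. v l j * w $ j) + v l n * w $ n))"
      using eq by simp
    also have "\<dots> = (\<Sum>l<n. \<Sum>j<n. a i l * v l j * w $ j) + (\<Sum>l<n. a i l * b l) * w $ n"
      by (simp add: algebra_simps sum.distrib sum_distrib_left sum_distrib_right col)
    also have "(\<Sum>l<n. \<Sum>j<n. a i l * v l j * w $ j) = (\<Sum>j<n. (\<Sum>l<n. a i l * v l j) * w $ j)"
      by (subst sum.swap) (simp add: sum_distrib_right)
    also have "\<dots> = (\<Sum>j<n. if i = j then w $ j else 0)"
      using inv[OF that] by (intro sum.cong) auto
    also have "\<dots> = w $ i" using that by simp
    finally show ?thesis by (simp add: eq_neg_iff_add_eq_0)
  qed
  have "w $ n \<noteq> 0"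
  proof
    assume "w $ n = 0"
    hence "w $ i = 0" if "i < Suc n" for i
      using sol[of i] that by (cases "i = n") auto
    hence "w = 0\<^sub>v (Suc n)" using w(1) by (intro eq_vecI) auto
    with w(2) show False ..
  qed
  have "0 = (\<Sum>j<n. b j * w $ j) + w $ n"
    using eq[of n] row corner by simp
  also have "(\<Sum>j<n. b j * w $ j) = - (\<Sum>i<n. \<Sum>j<n. a i j * b i * b j) * w $ n"
    using sol by (simp add: sum_negf sum_distrib_left sum_distrib_right mult_ac)
  finally have "(1 - (\<Sum>i<n. \<Sum>j<n. a i j * b i * b j)) * w $ n = 0"
    by (simp add: algebra_simps)
  with \<open>w $ n \<noteq> 0\<close> show ?thesis by simp
qed

text \<open>Sorting the terms by their degree in \<open>x M\<close> gives the shape required by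
  \<open>\<Phi>_coefficient_eq_0\<close>.\<close>

lemma quadratic_form_split:
  fixes a :: "nat \<Rightarrow> nat \<Rightarrow> 'a::comm_ring_1"
  assumes "M < n"
  shows "(\<Sum>i<n. \<Sum>j<n. a i j * x i * x j) = a M M * x M ^ 2
    + x M * (\<Sum>j\<in>{..<n} - {M}. (a M j + a j M) * x j)
    + (\<Sum>i\<in>{..<n} - {M}. \<Sum>j\<in>{..<n} - {M}. a i j * x i * x j)"
proof -
  have "(\<Sum>i<n. \<Sum>j<n. a i j * x i * x j)
      = (\<Sum>i<n. a i M * x i * x M + (\<Sum>j\<in>{..<n} - {M}. a i j * x i * x j))"
    using assms by (intro sum.cong refl sum.remove) auto
  also have "\<dots> = (\<Sum>i<n. a i M * x i * x M) + (\<Sum>i<n. \<Sum>j\<in>{..<n} - {M}. a i j * x i * x j)"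
    by (rule sum.distrib)
  also have "(\<Sum>i<n. a i M * x i * x M) = a M M * x M * x M + (\<Sum>i\<in>{..<n} - {M}. a i M * x i * x M)"
    using assms by (intro sum.remove) auto
  also have "(\<Sum>i<n. \<Sum>j\<in>{..<n} - {M}. a i j * x i * x j) = (\<Sum>j\<in>{..<n} - {M}. a M j * x M * x j)
      + (\<Sum>i\<in>{..<n} - {M}. \<Sum>j\<in>{..<n} - {M}. a i j * x i * x j)"
    using assms by (intro sum.remove) auto
  finally show ?thesis
    by (simp add: power2_eq_square algebra_simps sum.distrib sum_distrib_left sum_distrib_right)
qed

section \<open>Extension of a nonsingular configuration by one point\<close>

context gmq_kernel
begin

text \<open>A quadratic form determines only the symmetric part of \<open>a\<close>, hence the sum
  of two mirrored entries. It is the coefficient of \<open>\<Phi> (\<tau> j)\<close> in the factor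
  of \<open>\<Phi> (\<tau> M)\<close>.\<close>

lemma quadratic_form_not_constant:
  fixes a :: "nat \<Rightarrow> nat \<Rightarrow> real"
  assumes inj: "inj_on \<tau> {..<n}"
    and const: "\<And>t. (\<Sum>i<n. \<Sum>j<n. a i j * (1 + (t - \<tau> i) ^ (2 * k)) powr \<beta>
      * (1 + (t - \<tau> j) ^ (2 * k)) powr \<beta>) = 1"
    and M: "M < n" and max: "\<And>i. i < n \<Longrightarrow> \<tau> i \<le> \<tau> M"
    and j: "j < n" "j \<noteq> M"
  shows "a M j + a j M = 0"
proof -
  let ?J = "{..<n} - {M}"
  define Q where "Q z = (\<Sum>i<n. \<Sum>j<n. of_real (a i j) * \<Phi> (\<tau> i) z * \<Phi> (\<tau> j) z) - 1" for z
  have "Q analytic_on strip"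
    unfolding Q_def by (intro analytic_intros)
  hence "Q holomorphic_on strip" by (rule analytic_imp_holomorphic)
  have Q_real: "Q (of_real t) = 0" for t
  proof -
    have "Q (of_real t) = of_real ((\<Sum>i<n. \<Sum>j<n. a i j * (1 + (t - \<tau> i) ^ (2 * k)) powr \<beta>
      * (1 + (t - \<tau> j) ^ (2 * k)) powr \<beta>) - 1)"
      unfolding Q_def by (simp add: \<Phi>_of_real)
    thus ?thesis by (simp add: const)
  qed
  have Q0: "Q z = 0" if "z \<in> strip" for z
  proof (rule analytic_continuation[OF \<open>Q holomorphic_on strip\<close> open_strip connected_strip _ _ _ _ that])
    show "range of_real \<subseteq> strip" "(0::complex) \<in> strip" using Im_pos by (auto simp: strip_def)
    show "(0::complex) islimpt range of_real"
      unfolding islimpt_approachable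
    proof (intro allI impI)
      fix e :: real assume "e > 0"
      thus "\<exists>x'\<in>range of_real. x' \<noteq> (0::complex) \<and> dist x' 0 < e"
        by (intro bexI[of _ "of_real (e / 2)"] rangeI) (auto simp: norm_divide)
    qed
  qed (auto simp: Q_real)
  define G where "G z = (\<Sum>j\<in>?J. of_real (a M j + a j M) * \<Phi> (\<tau> j) z)" for z
  define H where "H z = (\<Sum>i\<in>?J. \<Sum>j\<in>?J. of_real (a i j) * \<Phi> (\<tau> i) z * \<Phi> (\<tau> j) z) - 1" for z
  have less: "\<tau> i < \<tau> M" if "i \<in> ?J" for i
    using that max[of i] inj M by (auto simp: inj_on_def order_less_le)
  have an: "\<Phi> (\<tau> i) analytic_on {of_real (\<tau> M) + \<zeta>}" if "i \<in> ?J" for i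
    using base_branch_point[OF less[OF that]] by (intro analytic_\<Phi>) auto
  have "\<forall>\<^sub>F z in nhds (of_real (\<tau> M) + \<zeta>). G z = 0"
  proof (rule \<Phi>_coefficient_eq_0)
    show "G analytic_on {of_real (\<tau> M) + \<zeta>}" "H analytic_on {of_real (\<tau> M) + \<zeta>}"
      unfolding G_def H_def by (intro analytic_intros an; assumption)+
    fix z assume "z \<in> strip"
    from Q0[OF this] show "of_real (a M M) * \<Phi> (\<tau> M) z ^ 2 + \<Phi> (\<tau> M) z * G z + H z = 0"
      unfolding Q_def quadratic_form_split[OF M] G_def H_def by (simp add: add_diff_eq)
  qed
  then obtain U where U: "open U" "of_real (\<tau> M) + \<zeta> \<in> U" "\<And>z. z \<in> U \<Longrightarrow> G z = 0"
    unfolding eventually_nhds by blast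
  have "\<forall>\<^sub>F y in at_right 0. of_real (\<tau> M) + \<zeta> - \<i> * of_real y \<in> U"
    using filterlim_ray[of "of_real (\<tau> M) + \<zeta>"] eventually_at_in_open'[OF U(1,2)]
    unfolding filterlim_iff by blast
  with ray_in_strip[of "\<tau> M"]
  have "\<forall>\<^sub>F y in at_right 0. of_real (\<tau> M) + \<zeta> - \<i> * of_real y \<in> U \<inter> strip"
    by eventually_elim simp
  \<comment> \<open>\<open>U\<close> surrounds a point on the edge of the strip. The ray provides a
    point of \<open>U\<close> inside the strip, from where \<open>G = 0\<close> spreads over the
    whole strip.\<close>
  then obtain z0 where z0: "z0 \<in> U \<inter> strip"
    using eventually_happens'[OF trivial_limit_at_right_real] by blast
  have "G analytic_on strip" unfolding G_def by (intro analytic_intros)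
  hence "G holomorphic_on strip" by (rule analytic_imp_holomorphic)
  have "G z = 0" if "z \<in> strip" for z
  proof (rule analytic_continuation[OF \<open>G holomorphic_on strip\<close> open_strip connected_strip _ _ _ _ that])
    show "U \<inter> strip \<subseteq> strip" "z0 \<in> strip" using z0 by auto
    show "z0 islimpt (U \<inter> strip)"
      using U(1) open_strip z0 by (intro interior_limit_point) (simp add: interior_open open_Int)
  qed (use U(3) in auto)
  hence "of_real (a M j + a j M) = (0::complex)"
    unfolding G_def using inj j
    by (intro linear_independence_\<Phi>[where J = ?J and \<tau> = \<tau> and c = "\<lambda>j. of_real (a M j + a j M)"])
       (auto simp: inj_on_def)
  thus ?thesis by (simp only: of_real_eq_0_iff)
qed

lemma collinear_matrix_step:
  assumes "det (collinear_matrix k \<beta> \<tau> n) \<noteq> 0"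
  shows "\<exists>t. det (collinear_matrix k \<beta> (\<tau>(n := t)) (Suc n)) \<noteq> 0"
proof (rule ccontr)
  assume "\<not> ?thesis"
  hence sing: "det (collinear_matrix k \<beta> (\<tau>(n := t)) (Suc n)) = 0" for t by blast
  define v where "v i j = (1 + (\<tau> i - \<tau> j) ^ (2 * k)) powr \<beta>" for i j
  have v_sym: "v i j = v j i" for i j
    unfolding v_def by (metis even_mult_iff even_numeral minus_diff_eq power_minus_even)
  have v_pos: "v i j > 0" for i j
  proof -
    have "(\<tau> i - \<tau> j) ^ (2 * k) \<ge> 0" by (simp add: power_mult)
    thus ?thesis unfolding v_def by (simp add: add_nonneg_eq_0_iff)
  qed
  have v_diag: "v i i = 1" for i
    using k unfolding v_def by (simp add: power_0_left)
  obtain a where av: "\<And>i j. i < n \<Longrightarrow> j < n \<Longrightarrow> (\<Sum>l<n. a i l * v l j) = (if i = j then 1 else 0)"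
    and va: "\<And>i j. i < n \<Longrightarrow> j < n \<Longrightarrow> (\<Sum>l<n. v i l * a l j) = (if i = j then 1 else 0)"
    using assms det_nonzero_inverse[of n v] unfolding collinear_matrix_def v_def by blast
  have const: "(\<Sum>i<n. \<Sum>j<n. a i j * (1 + (t - \<tau> i) ^ (2 * k)) powr \<beta>
      * (1 + (t - \<tau> j) ^ (2 * k)) powr \<beta>) = 1" for t
  proof (rule bordered_singular)
    define \<tau>' where "\<tau>' = \<tau>(n := t)"
    let ?v = "\<lambda>i j. (1 + (\<tau>' i - \<tau>' j) ^ (2 * k)) powr \<beta>"
    show "(\<Sum>l<n. a i l * ?v l j) = (if i = j then 1 else 0)" if "i < n" "j < n" for i j
      using av[OF that] that by (simp add: \<tau>'_def v_def)
    show "det (mat (Suc n) (Suc n) (\<lambda>(i, j). ?v i j)) = 0"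
      using sing[of t] unfolding collinear_matrix_def \<tau>'_def .
    show "?v i n = (1 + (t - \<tau> i) ^ (2 * k)) powr \<beta>" if "i < n" for i
      using that unfolding \<tau>'_def by simp (metis minus_diff_eq power2_minus power_mult)
    show "?v n i = (1 + (t - \<tau> i) ^ (2 * k)) powr \<beta>" if "i < n" for i
      using that unfolding \<tau>'_def by simp
    show "?v n n = 1" using k by (simp add: power_0_left)
  qed
  \<comment> \<open>Coinciding points would give two equal columns of \<open>v\<close>, although
    \<open>v\<close> is invertible.\<close>
  have inj: "inj_on \<tau> {..<n}"
  proof (rule inj_onI)
    fix i j assume ij: "i \<in> {..<n}" "j \<in> {..<n}" "\<tau> i = \<tau> j"
    hence "v l i = v l j" for l unfolding v_def by simp
    hence "(\<Sum>l<n. a i l * v l i) = (\<Sum>l<n. a i l * v l j)" by simp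
    with av[of i i] av[of i j] ij show "i = j" by (auto split: if_splits)
  qed
  have "n \<noteq> 0" using const[of 0] by (cases n) auto
  hence "Max (\<tau> ` {..<n}) \<in> \<tau> ` {..<n}" by (intro Max_in) auto
  then obtain M where M: "M < n" "\<tau> M = Max (\<tau> ` {..<n})" by auto
  have max: "\<tau> i \<le> \<tau> M" if "i < n" for i
    unfolding M(2) using that by simp
  have off: "a M j + a j M = 0" if "j < n" "j \<noteq> M" for j
    using quadratic_form_not_constant[OF inj const M(1) max that] .
  \<comment> \<open>Entry \<open>(M, j)\<close> of \<open>a * v\<close> is added to entry
    \<open>(j, M)\<close> of \<open>v * a\<close>. As \<open>v\<close> is symmetric, only mirrored
    sums of entries of \<open>a\<close> occur, and all but the one at \<open>M\<close>
    vanish.\<close>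
  have diag: "a M M * v M j = (if M = j then 1 else 0)" if "j < n" for j
  proof -
    have "(\<Sum>l<n. a M l * v l j) + (\<Sum>l<n. v j l * a l M) = (\<Sum>l<n. (a M l + a l M) * v l j)"
      by (simp add: v_sym[of j] sum.distrib algebra_simps)
    also have "\<dots> = (\<Sum>l<n. if l = M then 2 * a M M * v M j else 0)"
      using off by (intro sum.cong) auto
    also have "\<dots> = 2 * (a M M * v M j)" using M(1) by simp
    finally show ?thesis using av[OF M(1) that] va[OF that M(1)] by (auto split: if_splits)
  qed
  have aMM: "a M M = 1" using diag[OF M(1)] v_diag by simp
  have only_M: "j = M" if "j < n" for j
    using diag[OF that] v_pos[of M j] aMM by (auto split: if_splits)
  have "n = 1" using only_M[of 0] only_M[of 1] M(1) by linarith
  \<comment> \<open>At distance 1 from the only point the form takes the value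
    \<open>(2 powr \<beta>) ^ 2\<close>, which exceeds 1.\<close>
  hence "((1 + (\<tau> 0 + 1 - \<tau> 0) ^ (2 * k)) powr \<beta>) ^ 2 = 1"
    using const[of "\<tau> 0 + 1"] aMM M(1) by (simp add: power2_eq_square)
  moreover have "2 powr \<beta> > 1" using \<beta>(1) by simp
  ultimately show False by (simp add: power2_eq_1_iff)
qed

lemma exists_nonsingular_collinear:
  "\<exists>\<tau>. det (collinear_matrix k \<beta> \<tau> n) \<noteq> 0"
proof (induction n)
  case 0
  show ?case unfolding collinear_matrix_def by (simp add: det_def)
next
  case (Suc n)
  thus ?case using collinear_matrix_step by blast
qed

end

section \<open>Zero sets of functions that are analytic along lines\<close>

text \<open>Real analyticity on the whole line, expressed by a holomorphic extension so that complex
  analysis supplies the closure properties and the isolation of zeros.\<close>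

definition real_analytic :: "(real \<Rightarrow> real) \<Rightarrow> bool" where
  "real_analytic f \<longleftrightarrow> (\<exists>F. F analytic_on \<real> \<and> (\<forall>t. F (of_real t) = complex_of_real (f t)))"

lemma real_analytic_const [intro]: "real_analytic (\<lambda>_. c)"
  unfolding real_analytic_def by (rule exI[of _ "\<lambda>_. of_real c"]) simp

lemma real_analytic_ident [intro]: "real_analytic (\<lambda>t. t)"
  unfolding real_analytic_def by (rule exI[of _ "\<lambda>z. z"]) simp

lemma real_analytic_add:
  assumes "real_analytic f" and "real_analytic g"
  shows "real_analytic (\<lambda>t. f t + g t)"
proof -
  obtain F G where "F analytic_on \<real>" "\<And>t. F (of_real t) = complex_of_real (f t)"
    "G analytic_on \<real>" "\<And>t. G (of_real t) = complex_of_real (g t)"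
    using assms unfolding real_analytic_def by blast
  thus ?thesis unfolding real_analytic_def
    by (intro exI[of _ "\<lambda>z. F z + G z"]) (auto intro: analytic_on_add)
qed

lemma real_analytic_mult:
  assumes "real_analytic f" and "real_analytic g"
  shows "real_analytic (\<lambda>t. f t * g t)"
proof -
  obtain F G where "F analytic_on \<real>" "\<And>t. F (of_real t) = complex_of_real (f t)"
    "G analytic_on \<real>" "\<And>t. G (of_real t) = complex_of_real (g t)"
    using assms unfolding real_analytic_def by blast
  thus ?thesis unfolding real_analytic_def
    by (intro exI[of _ "\<lambda>z. F z * G z"]) (auto intro: analytic_on_mult)
qed

lemma real_analytic_sum:
  "(\<And>i. i \<in> I \<Longrightarrow> real_analytic (f i)) \<Longrightarrow> real_analytic (\<lambda>t. \<Sum>i\<in>I. f i t)"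
  by (induction I rule: infinite_finite_induct) (auto intro: real_analytic_add)

lemma real_analytic_prod:
  "(\<And>i. i \<in> I \<Longrightarrow> real_analytic (f i)) \<Longrightarrow> real_analytic (\<lambda>t. \<Prod>i\<in>I. f i t)"
  by (induction I rule: infinite_finite_induct) (auto intro: real_analytic_mult)

lemma real_analytic_power:
  "real_analytic f \<Longrightarrow> real_analytic (\<lambda>t. f t ^ n)"
  by (induction n) (auto intro: real_analytic_mult)

text \<open>Positivity keeps the extension off the branch cut at every real point, and analyticity
  is asked only there.\<close>

lemma real_analytic_powr:
  assumes "real_analytic f" and pos: "\<And>t. f t > 0"
  shows "real_analytic (\<lambda>t. f t powr b)"
proof -
  obtain F where F: "F analytic_on \<real>" "\<And>t. F (of_real t) = complex_of_real (f t)"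
    using assms(1) unfolding real_analytic_def by blast
  have "F z \<notin> \<real>\<^sub>\<le>\<^sub>0" if z: "z \<in> \<real>" for z
  proof -
    obtain t where "z = of_real t" using z by (auto elim: Reals_cases)
    thus ?thesis using F(2)[of t] pos[of t] by simp
  qed
  hence "(\<lambda>z. F z powr of_real b) analytic_on \<real>"
    using F(1) by (intro analytic_intros) auto
  moreover have "F (of_real t) powr of_real b = of_real (f t powr b)" for t
    using pos[of t] by (simp add: F(2) powr_of_real)
  ultimately show ?thesis unfolding real_analytic_def by blast
qed

lemma real_analytic_finite_zeros:
  assumes "real_analytic f" and "f c \<noteq> 0"
  shows "finite {t \<in> {a..b}. f t = 0}"
proof -
  obtain F where F: "F analytic_on \<real>" "\<And>t. F (of_real t) = complex_of_real (f t)"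
    using assms(1) unfolding real_analytic_def by blast
  then obtain U where U: "open U" "\<real> \<subseteq> U" "F holomorphic_on U"
    unfolding analytic_on_holomorphic by blast
  \<comment> \<open>\<open>U\<close> may be disconnected. The component of 0 contains the whole real
    axis, and with it \<open>c\<close>, which may lie outside \<open>{a..b}\<close>.\<close>
  define W where "W = connected_component_set U 0"
  have W: "open W" "connected W"
    unfolding W_def using U(1) by (auto intro: open_connected_component)
  have "connected (\<real> :: complex set)"
    unfolding Reals_def by (intro connected_continuous_image continuous_intros connected_UNIV)
  hence RW: "\<real> \<subseteq> W"
    unfolding W_def using U(2) by (intro connected_component_maximal) auto
  have hol: "F holomorphic_on W"
    using U(3) unfolding W_def by (rule holomorphic_on_subset) (rule connected_component_subset)
  show ?thesis
  proof (cases "F constant_on W")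
    case True
    hence "F (of_real t) = F (of_real c)" for t
      using RW unfolding constant_on_def by (metis Reals_of_real subsetD)
    hence "f t = f c" for t unfolding F(2) of_real_eq_iff .
    hence "f t \<noteq> 0" for t using assms(2) by metis
    thus ?thesis by simp
  next
    case False
    have "compact (complex_of_real ` {a..b})"
      by (intro compact_continuous_image continuous_intros compact_Icc)
    moreover have "complex_of_real ` {a..b} \<subseteq> W" using RW by auto
    ultimately have fin: "finite {z \<in> complex_of_real ` {a..b}. F z = 0}"
      using holomorphic_compact_finite_zeros[OF hol W] False by blast
    have "{z \<in> complex_of_real ` {a..b}. F z = 0} = complex_of_real ` {t \<in> {a..b}. f t = 0}"
      using F(2) by auto
    with fin have "finite (complex_of_real ` {t \<in> {a..b}. f t = 0})" by simp
    thus ?thesis by (rule finite_imageD) (simp add: inj_on_def)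
  qed
qed

text \<open>Fubini applied to \<open>(x, t) \<mapsto> G (x + t *\<^sub>R (a - x))\<close>: every line through \<open>a\<close> carries few zeros, so for some
  \<open>t < 1\<close> almost no \<open>x\<close> gives a zero, and \<open>x \<mapsto> x + t *\<^sub>R (a - x)\<close> is then an affine bijection.\<close>

lemma AE_nonzero_of_line_analytic:
  fixes G :: "'a::euclidean_space \<Rightarrow> real"
  assumes [measurable]: "G \<in> borel_measurable borel"
    and an: "\<And>x. real_analytic (\<lambda>t. G (x + t *\<^sub>R (a - x)))"
    and "G a \<noteq> 0"
  shows "AE x in lborel. G x \<noteq> 0"
proof -
  \<comment> \<open>The interval has positive length and avoids \<open>t = 1\<close>, where all
    lines meet in \<open>a\<close> and the affine map collapses.\<close>
  let ?P = "\<lambda>(x::'a) (t::real). t \<in> {0..1/2} \<longrightarrow> G (x + t *\<^sub>R (a - x)) \<noteq> 0"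
  have "AE t in lborel. ?P x t" for x
  proof -
    \<comment> \<open>The nonzero value is taken at parameter 1, where the line reaches
      \<open>a\<close>.\<close>
    have "finite {t \<in> {0..1/2}. G (x + t *\<^sub>R (a - x)) = 0}"
      using real_analytic_finite_zeros[OF an, of x 1 0 "1/2"] \<open>G a \<noteq> 0\<close> by simp
    hence "{t \<in> {0..1/2}. G (x + t *\<^sub>R (a - x)) = 0} \<in> null_sets lborel"
      by (rule finite_imp_null_set_lborel)
    thus ?thesis by (rule AE_I') auto
  qed
  hence "AE x in lborel. AE t in lborel. ?P x t" by simp
  moreover have "{x \<in> space (lborel \<Otimes>\<^sub>M lborel). ?P (fst x) (snd x)} \<in> sets (lborel \<Otimes>\<^sub>M lborel)"
    by measurable
  ultimately have AE_t: "AE t in lborel. AE x in lborel. ?P x t"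
    using lborel_pair.AE_commute[of ?P] by blast
  obtain t :: real where t: "t \<in> {0..1/2}" and AE_x: "AE x in lborel. ?P x t"
  proof (rule ccontr)
    assume "\<not> thesis"
    hence "AE t in lborel. (t::real) \<notin> {0..1/2}"
      using AE_t that by (auto elim!: eventually_mono)
    hence "emeasure lborel {0..1/2::real} = 0"
      by (subst (asm) AE_iff_measurable[of "{0..1/2}"]) auto
    thus False by simp
  qed
  have c: "1 - t \<noteq> 0" using t by auto
  have eq: "x + t *\<^sub>R (a - x) = t *\<^sub>R a + (1 - t) *\<^sub>R x" for x
    by (simp add: algebra_simps)
  have "AE x in lborel. G (t *\<^sub>R a + (1 - t) *\<^sub>R x) \<noteq> 0"
    using AE_x t by (auto elim!: eventually_mono simp: eq)
  hence "AE x in distr lborel borel (\<lambda>x. t *\<^sub>R a + (1 - t) *\<^sub>R x). G x \<noteq> 0"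
    by (subst AE_distr_iff) auto
  \<comment> \<open>Up to a constant factor, Lebesgue measure is its own image under the affine
    map.\<close>
  thus ?thesis
    by (subst lborel_affine[OF c, of "t *\<^sub>R a"], subst AE_density) auto
qed

text \<open>The coordinates of the good point \<open>a\<close> are replaced by random ones, one at a time.\<close>

lemma AE_PiM_nonzero_of_line_analytic:
  fixes F :: "(nat \<Rightarrow> 'a::euclidean_space) \<Rightarrow> real"
  assumes prob: "\<And>i. prob_space (N i)" and sets_N: "\<And>i. sets (N i) = sets borel"
    and ac: "\<And>i. absolutely_continuous lborel (N i)"
    and F: "F \<in> borel_measurable (PiM UNIV (\<lambda>_. borel))"
    and an: "\<And>x i y. real_analytic (\<lambda>t. F (x(i := y + t *\<^sub>R (x i - y))))"
    and a: "F a \<noteq> 0" and "finite I"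
  shows "AE x in PiM I N. F (\<lambda>i. if i \<in> I then x i else a i) \<noteq> 0"
  using \<open>finite I\<close>
proof (induction I)
  case empty
  thus ?case using a by simp
next
  case (insert i I)
  interpret product_prob_space N by (intro product_prob_spaceI prob)
  define mg where "mg J x j = (if j \<in> J then x j else a j)" for J x j
  have F_mg: "(\<lambda>x. F (mg J x)) \<in> borel_measurable (PiM J N)" for J
  proof (rule measurable_compose[OF _ F])
    show "mg J \<in> measurable (PiM J N) (PiM UNIV (\<lambda>_. borel))"
      unfolding mg_def
    proof (rule measurable_abs_UNIV)
      fix j
      have "(\<lambda>x. x j) \<in> borel_measurable (PiM J N)" if "j \<in> J"
        using measurable_component_singleton[OF that, of N]
        unfolding measurable_cong_sets[OF refl sets_N] .
      thus "(\<lambda>x. if j \<in> J then x j else a j) \<in> borel_measurable (PiM J N)"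
        by (cases "j \<in> J") auto
    qed
  qed
  define Z where "Z = {x \<in> space (PiM (insert i I) N). F (mg (insert i I) x) = 0}"
  have Z: "Z \<in> sets (PiM (insert i I) N)"
    unfolding Z_def using F_mg by measurable
  \<comment> \<open>By Fubini it suffices that almost every section of the zero set in direction
    \<open>i\<close> is null.\<close>
  have "AE x in PiM I N. (\<integral>\<^sup>+ y. indicator Z (x(i := y)) \<partial>N i) = 0"
    using insert.IH
  proof eventually_elim
    case (elim x)
    have [simp]: "mg (insert i I) (x(i := y)) = (mg I x)(i := y)" for y
      unfolding mg_def using insert.hyps by (auto simp: fun_eq_iff)
    have mg_eq: "mg I x = (\<lambda>j. if j \<in> I then x j else a j)"
      by (simp add: fun_eq_iff mg_def)
    \<comment> \<open>Coordinate \<open>i\<close> still holds its value from the good point, so the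
      induction hypothesis provides a nonzero value at \<open>a i\<close>.\<close>
    have mg_i: "mg I x i = a i" unfolding mg_def using insert.hyps by simp
    have "AE y in lborel. F ((mg I x)(i := y)) \<noteq> 0"
    proof (rule AE_nonzero_of_line_analytic)
      have "(\<lambda>y. (mg I x)(i := y)) \<in> measurable borel (PiM UNIV (\<lambda>_. borel))"
        unfolding fun_upd_def by (rule measurable_abs_UNIV) simp
      thus "(\<lambda>y. F ((mg I x)(i := y))) \<in> borel_measurable borel"
        using F by (rule measurable_compose)
      show "real_analytic (\<lambda>t. F ((mg I x)(i := y + t *\<^sub>R (a i - y))))" for y
        using an[of "mg I x" i y] by (simp add: mg_i)
      show "F ((mg I x)(i := a i)) \<noteq> 0"
        by (subst mg_i[symmetric], subst fun_upd_triv, subst mg_eq, rule elim)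
    qed
    hence "AE y in N i. F ((mg I x)(i := y)) \<noteq> 0"
      using absolutely_continuous_AE[OF _ ac[of i]] sets_N[of i] by auto
    hence "AE y in N i. indicator Z (x(i := y)) = (0::ennreal)"
      by eventually_elim (simp add: Z_def)
    thus ?case by (subst nn_integral_cong_AE) auto
  qed
  hence "(\<integral>\<^sup>+ x. (\<integral>\<^sup>+ y. indicator Z (x(i := y)) \<partial>N i) \<partial>PiM I N) = 0"
    by (subst nn_integral_cong_AE) auto
  hence "emeasure (PiM (insert i I) N) Z = 0"
    using product_nn_integral_insert[OF insert.hyps, of "indicator Z"] Z by simp
  hence "AE x in PiM (insert i I) N. F (mg (insert i I) x) \<noteq> 0"
    using Z by (intro AE_I[of _ _ Z]) (auto simp: Z_def)
  thus ?case unfolding mg_def .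
qed

section \<open>The interpolation determinant\<close>

lemma det_mat_Leibniz:
  "det (mat n n (\<lambda>(i, j). v i j)) = (\<Sum>p | p permutes {0..<n}. signof p * (\<Prod>i = 0..<n. v i (p i)))"
  by (auto simp: det_def intro!: sum.cong prod.cong arg_cong2[of _ _ _ _ "(*)"] dest: permutes_in_image)

text \<open>The even exponent removes the square root of the norm, so along a line the base of the
  power is a polynomial.\<close>

lemma gmq_norm:
  fixes u :: "'a::real_inner"
  shows "gmq \<epsilon> k \<beta> (norm u) = (1 + (\<epsilon>\<^sup>2 * (inner u u)) ^ k) powr \<beta>"
  unfolding gmq_def by (simp add: power_mult power_mult_distrib power2_norm_eq_inner)

lemma real_analytic_gmq_line:
  fixes p v :: "'a::real_inner"
  shows "real_analytic (\<lambda>t. gmq \<epsilon> k \<beta> (norm (p + t *\<^sub>R v)))"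
proof -
  have "real_analytic (\<lambda>t. (1 + (\<epsilon>\<^sup>2 * (inner p p + (2 * (inner p v) * t + (inner v v) * t ^ 2))) ^ k) powr \<beta>)"
  proof (rule real_analytic_powr)
    show "real_analytic (\<lambda>t. 1 + (\<epsilon>\<^sup>2 * (inner p p + (2 * (inner p v) * t + (inner v v) * t ^ 2))) ^ k)"
      by (intro real_analytic_add real_analytic_mult real_analytic_power
          real_analytic_const real_analytic_ident)
    fix t
    have "inner p p + (2 * (inner p v) * t + (inner v v) * t ^ 2) = inner (p + t *\<^sub>R v) (p + t *\<^sub>R v)"
      by (simp add: inner_simps inner_commute power2_eq_square algebra_simps)
    thus "1 + (\<epsilon>\<^sup>2 * (inner p p + (2 * (inner p v) * t + (inner v v) * t ^ 2))) ^ k > 0"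
      by (simp add: add_pos_nonneg)
  qed
  moreover have "inner p p + (2 * (inner p v) * t + (inner v v) * t ^ 2) = inner (p + t *\<^sub>R v) (p + t *\<^sub>R v)" for t
    by (simp add: inner_simps inner_commute power2_eq_square algebra_simps)
  ultimately show ?thesis by (simp add: gmq_norm)
qed

lemma real_analytic_interpolation_det:
  fixes x :: "nat \<Rightarrow> 'a::real_inner"
  shows "real_analytic (\<lambda>t. det (interpolation_matrix (gmq \<epsilon> k \<beta>) (x(m := y + t *\<^sub>R (x m - y))) n))"
proof -
  \<comment> \<open>Only point \<open>m\<close> moves, with velocity \<open>x m - y\<close>.
    Velocity 0 for the others makes every difference of points affine in \<open>t\<close> without
    case distinctions.\<close>
  define w where "w = (\<lambda>i. if i = m then x m - y else 0)"
  have line: "(x(m := y + t *\<^sub>R (x m - y))) i = (x(m := y)) i + t *\<^sub>R w i" for t i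
    unfolding w_def by simp
  have diff: "(x(m := y + t *\<^sub>R (x m - y))) i - (x(m := y + t *\<^sub>R (x m - y))) j
      = ((x(m := y)) i - (x(m := y)) j) + t *\<^sub>R (w i - w j)" for t i j
    unfolding line by (simp add: algebra_simps)
  show ?thesis
    unfolding interpolation_matrix_def det_mat_Leibniz diff
    by (intro real_analytic_sum real_analytic_mult real_analytic_prod
        real_analytic_const real_analytic_gmq_line)
qed

lemma measurable_interpolation_det:
  "(\<lambda>x :: nat \<Rightarrow> 'a::euclidean_space. det (interpolation_matrix (gmq \<epsilon> k \<beta>) x n))
    \<in> borel_measurable (PiM UNIV (\<lambda>_. borel))"
  unfolding interpolation_matrix_def det_mat_Leibniz gmq_def by measurable

lemma det_eq_0_if_points_coincide:
  assumes "i \<in> {1..n}" "j \<in> {1..n}" "i \<noteq> j" "x i = x j"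
  shows "det (interpolation_matrix \<phi> x n) = 0"
proof (rule det_identical_rows[of _ n "i - 1" "j - 1"])
  show "row (interpolation_matrix \<phi> x n) (i - 1) = row (interpolation_matrix \<phi> x n) (j - 1)"
    using assms by (intro eq_vecI) (auto simp: interpolation_matrix_def)
qed (use assms in \<open>auto simp: interpolation_matrix_def\<close>)

lemma exists_nonsingular_interpolation_matrix:
  assumes "\<epsilon> > 0" and "k \<ge> 1" and "\<beta> > 0" and "\<beta> \<notin> \<nat>"
  shows "\<exists>a :: nat \<Rightarrow> 'a::euclidean_space. det (interpolation_matrix (gmq \<epsilon> k \<beta>) a n) \<noteq> 0"
proof -
  obtain \<zeta> where "gmq_kernel k \<beta> \<zeta>"
    using extremal_root_of_minus_one[OF \<open>k \<ge> 1\<close>] assms unfolding gmq_kernel_def by metis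
  then obtain \<tau> where \<tau>: "det (collinear_matrix k \<beta> \<tau> n) \<noteq> 0"
    using gmq_kernel.exists_nonsingular_collinear by blast
  obtain e :: 'a where e: "norm e = 1" using vector_choose_size[of 1] by auto
  \<comment> \<open>Division by \<open>\<epsilon>\<close> cancels the shape parameter, and the shift
    accounts for sampling points numbered from 1.\<close>
  define a where "a i = (\<tau> (i - 1) / \<epsilon>) *\<^sub>R e" for i
  have entry: "gmq \<epsilon> k \<beta> (norm (a (Suc i) - a (Suc j))) = (1 + (\<tau> i - \<tau> j) ^ (2 * k)) powr \<beta>" for i j
  proof -
    have "\<epsilon> * norm (a (Suc i) - a (Suc j)) = \<bar>\<tau> i - \<tau> j\<bar>"
      using \<open>\<epsilon> > 0\<close> by (simp add: a_def e flip: scaleR_diff_left diff_divide_distrib)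
    thus ?thesis unfolding gmq_def by (simp add: power_even_abs)
  qed
  have "interpolation_matrix (gmq \<epsilon> k \<beta>) a n = collinear_matrix k \<beta> \<tau> n"
    unfolding interpolation_matrix_def collinear_matrix_def entry ..
  thus ?thesis using \<tau> by metis
qed

section \<open>Random sampling points\<close>

text \<open>By independence the joint law of the points is a product of absolutely continuous laws,
  under which the zero set of the determinant is null.\<close>

lemma AE_interpolation_det_nonzero:
  fixes X :: "nat \<Rightarrow> 'w \<Rightarrow> 'a::euclidean_space"
  assumes M: "prob_space M" and indep: "prob_space.indep_vars M (\<lambda>_. borel) X {1..n}"
    and ac: "\<And>i. i \<in> {1..n} \<Longrightarrow> absolutely_continuous lborel (distr M borel (X i))"
    and par: "\<epsilon> > 0" "k \<ge> 1" "\<beta> > 0" "\<beta> \<notin> \<nat>" and n: "n \<ge> 1"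
  shows "AE \<omega> in M. det (interpolation_matrix (gmq \<epsilon> k \<beta>) (\<lambda>i. X i \<omega>) n) \<noteq> 0"
proof -
  interpret prob_space M by (rule M)
  let ?F = "\<lambda>x :: nat \<Rightarrow> 'a. det (interpolation_matrix (gmq \<epsilon> k \<beta>) x n)"
  have rv: "random_variable borel (X i)" if "i \<in> {1..n}" for i
    using indep that unfolding indep_vars_def by blast
  obtain a :: "nat \<Rightarrow> 'a" where a: "?F a \<noteq> 0"
    using exists_nonsingular_interpolation_matrix[OF par] by blast
  \<comment> \<open>Indices outside \<open>{1..n}\<close> get the law of \<open>X 1\<close>, so that
    every factor is an absolutely continuous probability measure.\<close>
  define N where "N i = distr M borel (X (if i \<in> {1..n} then i else 1))" for i
  have "AE x in PiM {1..n} N. ?F (\<lambda>i. if i \<in> {1..n} then x i else a i) \<noteq> 0"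
  proof (rule AE_PiM_nonzero_of_line_analytic)
    show "prob_space (N i)" "absolutely_continuous lborel (N i)" for i
      unfolding N_def using n by (auto intro!: prob_space_distr rv ac)
    show "real_analytic (\<lambda>t. ?F (x(i := y + t *\<^sub>R (x i - y))))" for x i y
      by (rule real_analytic_interpolation_det[of _ _ _ x i y])
  qed (auto simp: N_def a intro: measurable_interpolation_det)
  also have "PiM {1..n} N = PiM {1..n} (\<lambda>i. distr M borel (X i))"
    by (intro PiM_cong) (auto simp: N_def)
  also have "\<dots> = distr M (PiM {1..n} (\<lambda>_. borel)) (\<lambda>\<omega>. \<lambda>i\<in>{1..n}. X i \<omega>)"
    using indep n by (subst (asm) indep_vars_iff_distr_eq_PiM') (auto intro: rv)
  finally have "AE \<omega> in M. ?F (\<lambda>i. if i \<in> {1..n} then (\<lambda>i\<in>{1..n}. X i \<omega>) i else a i) \<noteq> 0"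
    by (rule AE_distrD[rotated]) (intro measurable_restrict rv)
  \<comment> \<open>The matrix reads only the points 1 to \<open>n\<close>, so the filling by
    \<open>a\<close> is invisible.\<close>
  moreover have "interpolation_matrix \<phi> (\<lambda>i. if i \<in> {1..n} then (\<lambda>i\<in>{1..n}. X i \<omega>) i else a i) n
      = interpolation_matrix \<phi> (\<lambda>i. X i \<omega>) n" for \<phi> \<omega>
    unfolding interpolation_matrix_def by (intro cong_mat) auto
  ultimately show ?thesis by simp
qed

lemma invertible_mat_if_det_nonzero:
  fixes A :: "'a::field mat"
  assumes "A \<in> carrier_mat n n" and "det A \<noteq> 0"
  shows "invertible_mat A"
proof -
  obtain B where "B \<in> carrier_mat n n" "B * A = 1\<^sub>m n" "A * B = 1\<^sub>m n"
    using det_non_zero_imp_unit[OF assms] unfolding Units_def ring_mat_def by auto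
  thus ?thesis using assms(1) unfolding invertible_mat_def inverts_mat_def by auto
qed

theorem theorem1:
  fixes M :: "'w measure"
    and X :: "nat \<Rightarrow> 'w \<Rightarrow> real ^ 'd::finite"
    and \<Omega> :: "(real ^ 'd) set"
    and \<sigma> :: "real ^ 'd \<Rightarrow> real"
    and \<epsilon> \<beta> :: real
    and k n :: nat
  assumes "open \<Omega>" and "connected \<Omega>"
    and "integrable (lebesgue_on \<Omega>) \<sigma>"
    and "\<And>x. x \<in> \<Omega> \<Longrightarrow> 0 \<le> \<sigma> x"
    and "(\<integral>x. \<sigma> x \<partial>lebesgue_on \<Omega>) = 1"
    and "prob_space M"
    and "prob_space.indep_vars M (\<lambda>_. borel) X {1..}"
    and "\<And>i \<omega>. 1 \<le> i \<Longrightarrow> \<omega> \<in> space M \<Longrightarrow> X i \<omega> \<in> \<Omega>"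
    and "\<And>i A. 1 \<le> i \<Longrightarrow> A \<in> sets borel \<Longrightarrow> A \<subseteq> \<Omega> \<Longrightarrow>
           measure M {\<omega> \<in> space M. X i \<omega> \<in> A} = (\<integral>x. \<sigma> x \<partial>lebesgue_on A)"
    and "0 < \<epsilon>" and "1 \<le> k" and "1 < \<beta>" and "\<beta> \<notin> \<nat>"
    and "1 \<le> n"
  shows "(AE \<omega> in M. inj_on (\<lambda>i. X i \<omega>) {1..n}) \<and>
         (AE \<omega> in M. invertible_mat (interpolation_matrix (gmq \<epsilon> k \<beta>) (\<lambda>i. X i \<omega>) n))"
proof -
  interpret prob_space M by fact
  have rv: "random_variable borel (X i)" if "1 \<le> i" for i
    using assms(7) that unfolding indep_vars_def by auto
  \<comment> \<open>The law is given on Borel subsets of \<open>\<Omega>\<close>, so a null set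
    \<open>A\<close> is first cut down to \<open>A \<inter> \<Omega>\<close>, over which the
    integral of \<open>\<sigma>\<close> is 0.\<close>
  have ac: "absolutely_continuous lborel (distr M borel (X i))" if "1 \<le> i" for i
    unfolding absolutely_continuous_def
  proof
    fix A :: "(real ^ 'd) set" assume A: "A \<in> null_sets lborel"
    hence [measurable]: "A \<in> sets borel" by auto
    have A\<Omega>: "A \<inter> \<Omega> \<in> sets borel" using assms(1) by auto
    have "AE x in lebesgue. x \<notin> A"
      using A by (intro AE_not_in null_sets_completionI)
    hence "AE x in lebesgue_on (A \<inter> \<Omega>). \<sigma> x = 0"
      using A\<Omega> by (subst AE_restrict_space_iff) auto
    hence "measure M {\<omega> \<in> space M. X i \<omega> \<in> A \<inter> \<Omega>} = 0"
      using assms(9)[OF that A\<Omega>] integral_eq_zero_AE by auto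
    \<comment> \<open>The values of \<open>X i\<close> lie in \<open>\<Omega>\<close>, so the cut
      does not change the preimage.\<close>
    moreover have "{\<omega> \<in> space M. X i \<omega> \<in> A \<inter> \<Omega>} = X i -` A \<inter> space M"
      using assms(8)[OF that] by auto
    ultimately show "A \<in> null_sets (distr M borel (X i))"
      using rv[OF that] by (auto simp: null_sets_def emeasure_distr emeasure_eq_measure)
  qed
  have "AE \<omega> in M. det (interpolation_matrix (gmq \<epsilon> k \<beta>) (\<lambda>i. X i \<omega>) n) \<noteq> 0"
  proof (rule AE_interpolation_det_nonzero)
    show "indep_vars (\<lambda>_. borel) X {1..n}"
      using assms(7) by (rule indep_vars_subset) auto
    show "absolutely_continuous lborel (distr M borel (X i))" if "i \<in> {1..n}" for i
      using ac that by simp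
  qed (use assms in auto)
  \<comment> \<open>A nonzero determinant gives both claims, since coinciding points would produce
    two equal rows.\<close>
  thus ?thesis
  proof (intro conjI; elim AE_mp; intro AE_I2 impI)
    fix \<omega> assume det: "det (interpolation_matrix (gmq \<epsilon> k \<beta>) (\<lambda>i. X i \<omega>) n) \<noteq> 0"
    show "inj_on (\<lambda>i. X i \<omega>) {1..n}"
      using det det_eq_0_if_points_coincide[of _ n _ "\<lambda>i. X i \<omega>"] by (intro inj_onI) blast
    show "invertible_mat (interpolation_matrix (gmq \<epsilon> k \<beta>) (\<lambda>i. X i \<omega>) n)"
      using det by (intro invertible_mat_if_det_nonzero[of _ n]) (auto simp: interpolation_matrix_def)
  qed
qed

end
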